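(* Let $\alpha>0$ be fixed, let $\beta\in(0,\alpha)$, and let $\mathcal{F}\subseteq\mathcal{P}(\mathbb{R}^n)$ be a non-empty family of probability measures. Then $E^{\mathcal{F}}_\alpha(\beta)\in\mathbb{R}$ for every $\beta\in(0,\alpha]$ and, in addition, $E^{\mathcal{F}}_\alpha:(0,\alpha]\to\mathbb{R}$ is a continuous, concave function. Moreover, $E_\alpha$ is non-decreasing on $(0,\alpha]$.
   Context: $\mathcal{P}(\mathbb{R}^n)$ is the set of probability measures on $\mathbb{R}^n$. For $0<\beta\le\alpha$ put $W_{\alpha,\beta}(x-y)=\frac{|x-y|^\alpha}{\alpha}-\frac{|x-y|^\beta}{\beta}$, and let $\mathcal{E}_{\alpha,\beta}:\mathcal{P}(\mathbb{R}^n)\to\mathbb{R}$ be the interaction energy $\mathcal{E}_{\alpha,\beta}[\mu]=\frac12\iint_{\mathbb{R}^n\times\mathbb{R}^n}W_{\alpha,\beta}(x-y)\,d\mu(x)d\mu(y)$. For $\mathcal{F}\subseteq\mathcal{P}(\mathbb{R}^n)$, $E^{\mathcal{F}}_\alpha(\beta):=\inf_{\mu\in\mathcal{F}}\mathcal{E}_{\alpha,\beta}[\mu]$, and $E_\alpha(\beta):=E^{\mathcal{P}(\mathbb{R}^n)}_\alpha(\beta)$.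
   Formalization: The energy may be +∞ for heavy-tailed measures, so the claim fails for families whose members all have infinite energy; it is additionally assumed that some measure in F has finite energy for the given β in (0,α). *)

theory Defs
  imports "HOL-Probability.Probability"
begin

definition borel_prob_measures :: "'a::topological_space measure set"
  where "borel_prob_measures = {\<mu>. prob_space \<mu> \<and> sets \<mu> = sets borel}"

definition power_law_potential :: "real \<Rightarrow> real \<Rightarrow> 'a::real_normed_vector \<Rightarrow> real"
  where "power_law_potential \<alpha> \<beta> z = norm z powr \<alpha> / \<alpha> - norm z powr \<beta> / \<beta>"

text \<open>
  The integral of a real function as the integral of its positive part minus that of its
  negative part. It is meaningful when one of the two parts is finite. This replaces the Bochner
  integral, which is \<open>0\<close> for a function whose integral is \<open>\<infinity>\<close>.
\<close>

definition ereal_integral :: "'a measure \<Rightarrow> ('a \<Rightarrow> real) \<Rightarrow> ereal"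
  where "ereal_integral M f =
    enn2ereal (\<integral>\<^sup>+ x. ennreal (f x) \<partial>M) - enn2ereal (\<integral>\<^sup>+ x. ennreal (- f x) \<partial>M)"

text \<open>
  For \<open>0 < \<beta> \<le> \<alpha>\<close> the potential is bounded below by \<open>1 / \<alpha> - 1 / \<beta>\<close>, so the energy of a
  probability measure is well defined in \<open>(-\<infinity>, \<infinity>]\<close>; it is \<open>\<infinity>\<close> if \<open>\<beta> < \<alpha>\<close> and the tails of
  the measure are too heavy.
\<close>

definition interaction_energy ::
    "real \<Rightarrow> real \<Rightarrow> 'a::real_normed_vector measure \<Rightarrow> ereal"
  where "interaction_energy \<alpha> \<beta> \<mu> =
    ereal (1 / 2) *
      ereal_integral (\<mu> \<Otimes>\<^sub>M \<mu>) (\<lambda>(x, y). power_law_potential \<alpha> \<beta> (x - y))"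

definition min_energy ::
    "'a::real_normed_vector measure set \<Rightarrow> real \<Rightarrow> real \<Rightarrow> ereal"
  where "min_energy \<F> \<alpha> \<beta> = (INF \<mu>\<in>\<F>. interaction_energy \<alpha> \<beta> \<mu>)"

end

theory Submission
  imports Defs
begin

text \<open>
  For a fixed displacement \<open>z\<close> the map \<open>\<beta> \<mapsto> |z|\<^sup>\<beta> / \<beta>\<close> is convex, so the potential is concave in
  \<open>\<beta>\<close>. Integration and passage to the infimum over a family preserve concavity, which gives
  concavity of the minimal energy as soon as this is known to be finite. Concavity in turn gives
  continuity on the open interval \<open>(0, \<alpha>)\<close>.

  Finiteness has two sides. From below, the potential is at least \<open>1 / \<alpha> - 1 / \<beta>\<close>. From above, the
  term \<open>|z|\<^sup>\<alpha>\<close> dominates \<open>|z|\<^sup>\<beta>\<close> for \<open>\<beta> < \<alpha>\<close>, so the energy at such a \<open>\<beta>\<close> is finite exactly if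
  \<open>|x - y|\<^sup>\<alpha>\<close> is integrable against \<open>\<mu> \<otimes> \<mu>\<close>. This condition does not involve \<open>\<beta>\<close>: a measure with
  finite energy at one exponent below \<open>\<alpha>\<close> has finite energy at all of them. A measure that
  violates it has infinite energy throughout \<open>(0, \<alpha>)\<close> and hence has no influence on the infimum
  there, while its energy at \<open>\<alpha>\<close> is \<open>0\<close>, like that of every other measure, because the potential
  vanishes at \<open>\<beta> = \<alpha>\<close>.

  Concavity does not exclude a downward jump at the right endpoint \<open>\<alpha>\<close>. There the minimal energy
  lies between \<open>(1 / \<alpha> - 1 / \<beta>) / 2\<close> and the energy of a single measure with finite moment, and
  both tend to \<open>0\<close>, the latter by dominated convergence.

  For the family of all probability measures, a point mass shows that the minimal energy is at
  most \<open>0\<close>, which is its value at \<open>\<alpha>\<close>. A concave function that attains its maximum at the right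
  endpoint is non-decreasing.
\<close>

section \<open>The potential as a function of the exponent\<close>

text \<open>
  As a function of \<open>|z|\<close> the potential is minimal at \<open>|z| = 1\<close>. The bound is Young's inequality for
  \<open>|z|\<^sup>\<beta> = (|z|\<^sup>\<alpha>)\<^bsup>\<beta>/\<alpha>\<^esup> \<cdot> 1\<^bsup>1-\<beta>/\<alpha>\<^esup>\<close>.
\<close>

lemma power_law_potential_lower_bound:
  assumes "0 < \<beta>" "\<beta> \<le> \<alpha>"
  shows "1 / \<alpha> - 1 / \<beta> \<le> power_law_potential \<alpha> \<beta> z"
proof (cases "z = 0")
  case True
  with assms show ?thesis
    by (simp add: power_law_potential_def frac_le)
next
  case False
  let ?r = "norm z powr \<alpha>"
  have "?r powr (\<beta> / \<alpha>) * 1 powr (1 - \<beta> / \<alpha>) \<le> \<beta> / \<alpha> * ?r + (1 - \<beta> / \<alpha>) * 1"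
    using assms False by (intro Youngs_inequality_0) auto
  then have "norm z powr \<beta> \<le> \<beta> / \<alpha> * ?r + (1 - \<beta> / \<alpha>)"
    using assms by (simp add: powr_powr)
  then have "norm z powr \<beta> / \<beta> \<le> (\<beta> / \<alpha> * ?r + (1 - \<beta> / \<alpha>)) / \<beta>"
    using assms by (intro divide_right_mono) auto
  also have "\<dots> = ?r / \<alpha> + 1 / \<beta> - 1 / \<alpha>"
    using assms by (simp add: field_simps)
  finally show ?thesis
    by (simp add: power_law_potential_def)
qed

text \<open>
  The bound is uniform in \<open>\<beta> \<in> [\<gamma>, \<alpha>]\<close>, so its right-hand side can serve as the dominating function
  when \<open>\<beta>\<close> tends to \<open>\<alpha>\<close>.
\<close>

lemma power_law_potential_abs_bound:
  assumes "0 < \<gamma>" "\<gamma> \<le> \<beta>" "\<beta> \<le> \<alpha>"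
  shows "\<bar>power_law_potential \<alpha> \<beta> z\<bar> \<le> norm z powr \<alpha> / \<alpha> + 1 / \<gamma>"
proof -
  have "1 / \<alpha> - 1 / \<beta> \<le> power_law_potential \<alpha> \<beta> z"
    using assms by (intro power_law_potential_lower_bound) auto
  moreover have "1 / \<beta> \<le> 1 / \<gamma>" "0 \<le> 1 / \<alpha>" "0 \<le> 1 / \<gamma>"
    "0 \<le> norm z powr \<alpha> / \<alpha>" "0 \<le> norm z powr \<beta> / \<beta>"
    using assms by (auto simp: frac_le)
  ultimately show ?thesis
    unfolding power_law_potential_def by linarith
qed

text \<open>
  Half of the attractive term absorbs the repulsive one outside a large ball, and inside the ball
  the repulsive term is bounded. Thus integrability of the potential at one exponent below \<open>\<alpha>\<close>
  controls the moment of order \<open>\<alpha>\<close>.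
\<close>

lemma power_law_potential_coercive:
  assumes "0 < \<beta>" "\<beta> < \<alpha>"
  obtains C where "\<And>z :: 'a::real_normed_vector.
    norm z powr \<alpha> / (2 * \<alpha>) \<le> power_law_potential \<alpha> \<beta> z + C"
proof
  \<comment> \<open>\<open>R\<close> is the radius at which \<open>|z|\<^sup>\<beta> / \<beta> = |z|\<^sup>\<alpha> / (2\<alpha>)\<close>.\<close>
  define R where "R = (2 * \<alpha> / \<beta>) powr (1 / (\<alpha> - \<beta>))"
  fix z :: 'a
  show "norm z powr \<alpha> / (2 * \<alpha>) \<le> power_law_potential \<alpha> \<beta> z + R powr \<beta> / \<beta>"
  proof (cases "norm z \<le> R")
    case True
    then have "norm z powr \<beta> / \<beta> \<le> R powr \<beta> / \<beta>"
      using assms by (intro divide_right_mono powr_mono2) auto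
    moreover have "norm z powr \<alpha> / (2 * \<alpha>) \<le> norm z powr \<alpha> / \<alpha>"
      using assms by (simp add: field_simps)
    ultimately show ?thesis
      unfolding power_law_potential_def by linarith
  next
    case False
    have "0 < R"
      using assms by (simp add: R_def)
    have "2 * \<alpha> / \<beta> = R powr (\<alpha> - \<beta>)"
      using assms by (simp add: R_def powr_powr)
    also have "\<dots> \<le> norm z powr (\<alpha> - \<beta>)"
      using False assms \<open>0 < R\<close> by (intro powr_mono2) auto
    finally have "2 * \<alpha> / \<beta> * norm z powr \<beta> \<le> norm z powr (\<alpha> - \<beta>) * norm z powr \<beta>"
      by (intro mult_right_mono) auto
    also have "\<dots> = norm z powr \<alpha>"
      by (simp flip: powr_add)
    finally have "norm z powr \<beta> / \<beta> \<le> norm z powr \<alpha> / (2 * \<alpha>)"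
      using assms by (simp add: field_simps)
    moreover have "norm z powr \<alpha> / \<alpha> = norm z powr \<alpha> / (2 * \<alpha>) + norm z powr \<alpha> / (2 * \<alpha>)"
      by simp
    moreover have "0 \<le> R powr \<beta> / \<beta>"
      using assms by simp
    ultimately show ?thesis
      unfolding power_law_potential_def by linarith
  qed
qed

text \<open>
  With \<open>L = ln |z|\<close> one has \<open>|z|\<^sup>\<beta> / \<beta> = exp (\<beta> L - ln \<beta>)\<close>. The exponent is convex in \<open>\<beta>\<close>, and the
  exponential function is convex and increasing.
\<close>

lemma concave_on_power_law_potential:
  "concave_on {0<..} (\<lambda>\<beta>. power_law_potential \<alpha> \<beta> z)"
proof (cases "z = 0")
  case True
  then show ?thesis
    by (simp add: power_law_potential_def concave_on_def convex_on_def)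
next
  case False
  define L where "L = ln (norm z)"
  have eq: "power_law_potential \<alpha> \<beta> z = exp (\<alpha> * L) / \<alpha> - exp (\<beta> * L) / \<beta>" for \<beta>
    using False by (simp add: power_law_potential_def powr_def L_def)
  have "convex_on {0<..} (\<lambda>\<beta>. exp (\<beta> * L) / \<beta>)"
  proof (rule convex_onI)
    fix t x y :: real
    assume t: "0 < t" "t < 1" and "x \<in> {0<..}" "y \<in> {0<..}"
    then have xy: "0 < x" "0 < y"
      by auto
    let ?g = "\<lambda>\<beta>. \<beta> * L - ln \<beta>"
    have exp_g: "exp (?g \<beta>) = exp (\<beta> * L) / \<beta>" if "0 < \<beta>" for \<beta>
      using that by (simp add: exp_diff)
    have z: "0 < (1 - t) *\<^sub>R x + t *\<^sub>R y"
      using t xy by (auto intro!: add_pos_pos)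
    have "(1 - t) * ln x + t * ln y \<le> ln ((1 - t) *\<^sub>R x + t *\<^sub>R y)"
      using t xy by (intro concave_onD[OF ln_concave]) auto
    then have "?g ((1 - t) *\<^sub>R x + t *\<^sub>R y) \<le> (1 - t) * ?g x + t * ?g y"
      by (simp add: algebra_simps)
    then have "exp (?g ((1 - t) *\<^sub>R x + t *\<^sub>R y)) \<le> exp ((1 - t) * ?g x + t * ?g y)"
      by (simp only: exp_le_cancel_iff)
    also have "\<dots> \<le> (1 - t) * exp (?g x) + t * exp (?g y)"
      using convex_onD[OF exp_convex, of t "?g x" "?g y"] t by simp
    finally show "exp (((1 - t) *\<^sub>R x + t *\<^sub>R y) * L) / ((1 - t) *\<^sub>R x + t *\<^sub>R y)
        \<le> (1 - t) * (exp (x * L) / x) + t * (exp (y * L) / y)"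
      by (simp only: exp_g[OF z] exp_g[OF xy(1)] exp_g[OF xy(2)])
  qed simp
  then have "convex_on {0<..} (\<lambda>\<beta>. - (exp (\<alpha> * L) / \<alpha>) + exp (\<beta> * L) / \<beta>)"
    by (intro convex_on_add) (auto simp: convex_on_const)
  then show ?thesis
    unfolding eq concave_on_def by simp
qed

section \<open>Integrals of functions bounded below\<close>

lemma ereal_integral_eq_integral:
  assumes "integrable M f"
  shows "ereal_integral M f = ereal (\<integral>x. f x \<partial>M)"
proof -
  have "(\<integral>\<^sup>+x. ennreal (f x) \<partial>M) \<noteq> \<top>" "(\<integral>\<^sup>+x. ennreal (- f x) \<partial>M) \<noteq> \<top>"
    using assms by (auto simp: real_integrable_def)
  then show ?thesis
    unfolding ereal_integral_def real_lebesgue_integral_def[OF assms]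
    by (cases "\<integral>\<^sup>+x. ennreal (f x) \<partial>M"; cases "\<integral>\<^sup>+x. ennreal (- f x) \<partial>M") auto
qed

lemma ereal_integral_eq_PInfty:
  assumes "prob_space M" "f \<in> borel_measurable M" "\<And>x. c \<le> f x" "\<not> integrable M f"
  shows "ereal_integral M f = \<infinity>"
proof -
  interpret prob_space M by fact
  have "(\<integral>\<^sup>+x. ennreal (- f x) \<partial>M) \<le> (\<integral>\<^sup>+x. ennreal (- c) \<partial>M)"
    using assms(3) by (intro nn_integral_mono ennreal_leI) auto
  also have "\<dots> < \<top>"
    by (simp add: emeasure_space_1)
  finally have "(\<integral>\<^sup>+x. ennreal (- f x) \<partial>M) < \<top>" .
  moreover from this have "(\<integral>\<^sup>+x. ennreal (f x) \<partial>M) = \<top>"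
    using assms(2,4) by (auto simp: real_integrable_def)
  ultimately show ?thesis
    unfolding ereal_integral_def by (cases "\<integral>\<^sup>+x. ennreal (- f x) \<partial>M") auto
qed

section \<open>The energy of one measure\<close>

text \<open>
  The moment is that of the difference of two independent points, not of \<open>\<mu>\<close> about the origin:
  this is the form in which it occurs in the energy.
\<close>

definition finite_moment :: "real \<Rightarrow> 'a::real_normed_vector measure \<Rightarrow> bool"
  where "finite_moment \<alpha> \<mu> \<longleftrightarrow>
    integrable (\<mu> \<Otimes>\<^sub>M \<mu>) (\<lambda>p. norm (fst p - snd p) powr \<alpha>)"

lemma prob_space_pair_borel:
  assumes "\<mu> \<in> borel_prob_measures"
  shows "prob_space (\<mu> \<Otimes>\<^sub>M \<mu>)"
proof -
  interpret prob_space \<mu>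
    using assms by (simp add: borel_prob_measures_def)
  interpret pair_prob_space \<mu> \<mu> ..
  show ?thesis
    by (rule P.prob_space_axioms)
qed

lemma borel_measurable_power_law_potential:
  fixes \<mu> :: "'a::{real_normed_vector, second_countable_topology} measure"
  assumes "\<mu> \<in> borel_prob_measures"
  shows "(\<lambda>p. norm (fst p - snd p) powr \<alpha>) \<in> borel_measurable (\<mu> \<Otimes>\<^sub>M \<mu>)"
    and "(\<lambda>p. power_law_potential \<alpha> \<beta> (fst p - snd p)) \<in> borel_measurable (\<mu> \<Otimes>\<^sub>M \<mu>)"
proof -
  have "sets (\<mu> \<Otimes>\<^sub>M \<mu>) = sets (borel \<Otimes>\<^sub>M borel)"
    using assms by (intro sets_pair_measure_cong) (auto simp: borel_prob_measures_def)
  note [measurable_cong] = this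
  show "(\<lambda>p. norm (fst p - snd p) powr \<alpha>) \<in> borel_measurable (\<mu> \<Otimes>\<^sub>M \<mu>)"
    by measurable
  show "(\<lambda>p. power_law_potential \<alpha> \<beta> (fst p - snd p)) \<in> borel_measurable (\<mu> \<Otimes>\<^sub>M \<mu>)"
    unfolding power_law_potential_def by measurable
qed

lemma integrable_power_law_potential:
  fixes \<mu> :: "'a::{real_normed_vector, second_countable_topology} measure"
  assumes \<mu>: "\<mu> \<in> borel_prob_measures" and "finite_moment \<alpha> \<mu>" and "0 < \<beta>" "\<beta> \<le> \<alpha>"
  shows "integrable (\<mu> \<Otimes>\<^sub>M \<mu>) (\<lambda>p. power_law_potential \<alpha> \<beta> (fst p - snd p))"
proof (rule Bochner_Integration.integrable_bound)
  interpret prob_space "\<mu> \<Otimes>\<^sub>M \<mu>"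
    using \<mu> by (rule prob_space_pair_borel)
  show "integrable (\<mu> \<Otimes>\<^sub>M \<mu>) (\<lambda>p. norm (fst p - snd p) powr \<alpha> / \<alpha> + 1 / \<beta>)"
    using assms(2) by (auto simp: finite_moment_def)
  show "AE p in \<mu> \<Otimes>\<^sub>M \<mu>. norm (power_law_potential \<alpha> \<beta> (fst p - snd p))
      \<le> norm (norm (fst p - snd p) powr \<alpha> / \<alpha> + 1 / \<beta>)"
    using power_law_potential_abs_bound[of \<beta> \<beta> \<alpha>] assms(3,4)
    by (auto intro!: AE_I2 order_trans[OF _ abs_ge_self])
qed (use borel_measurable_power_law_potential[OF \<mu>] in auto)

lemma interaction_energy_eq:
  fixes \<mu> :: "'a::{real_normed_vector, second_countable_topology} measure"
  assumes "\<mu> \<in> borel_prob_measures" "finite_moment \<alpha> \<mu>" "0 < \<beta>" "\<beta> \<le> \<alpha>"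
  shows "interaction_energy \<alpha> \<beta> \<mu> =
    ereal (1 / 2 * (\<integral>p. power_law_potential \<alpha> \<beta> (fst p - snd p) \<partial>(\<mu> \<Otimes>\<^sub>M \<mu>)))"
  by (simp add: interaction_energy_def case_prod_beta'
      ereal_integral_eq_integral[OF integrable_power_law_potential[OF assms]])

text \<open>
  The exponent \<open>\<beta>\<close> must be strictly below \<open>\<alpha>\<close> here: for \<open>\<beta> = \<alpha>\<close> the two terms of the potential
  cancel and every measure has energy \<open>0\<close>.
\<close>

lemma interaction_energy_eq_PInfty:
  fixes \<mu> :: "'a::{real_normed_vector, second_countable_topology} measure"
  assumes \<mu>: "\<mu> \<in> borel_prob_measures" and "\<not> finite_moment \<alpha> \<mu>" and \<beta>: "0 < \<beta>" "\<beta> < \<alpha>"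
  shows "interaction_energy \<alpha> \<beta> \<mu> = \<infinity>"
proof -
  interpret prob_space "\<mu> \<Otimes>\<^sub>M \<mu>"
    using \<mu> by (rule prob_space_pair_borel)
  let ?W = "\<lambda>p. power_law_potential \<alpha> \<beta> (fst p - snd p)"
  have "\<not> integrable (\<mu> \<Otimes>\<^sub>M \<mu>) ?W"
  proof
    assume int: "integrable (\<mu> \<Otimes>\<^sub>M \<mu>) ?W"
    obtain C where C: "norm z powr \<alpha> / (2 * \<alpha>) \<le> power_law_potential \<alpha> \<beta> z + C" for z :: 'a
      using power_law_potential_coercive[OF \<beta>] by metis
    have bound: "norm (norm z powr \<alpha>) \<le> norm (2 * \<alpha> * (power_law_potential \<alpha> \<beta> z + C))"
      for z :: 'a
    proof -
      have "norm z powr \<alpha> \<le> 2 * \<alpha> * (power_law_potential \<alpha> \<beta> z + C)"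
        using C[of z] \<beta> by (simp add: field_simps)
      then show ?thesis
        by simp
    qed
    have "integrable (\<mu> \<Otimes>\<^sub>M \<mu>) (\<lambda>p. norm (fst p - snd p) powr \<alpha>)"
    proof (rule Bochner_Integration.integrable_bound)
      show "integrable (\<mu> \<Otimes>\<^sub>M \<mu>) (\<lambda>p. 2 * \<alpha> * (?W p + C))"
        using int by simp
    qed (use bound borel_measurable_power_law_potential(1)[OF \<mu>] in auto)
    with assms(2) show False
      by (simp add: finite_moment_def)
  qed
  then have "ereal_integral (\<mu> \<Otimes>\<^sub>M \<mu>) ?W = \<infinity>"
    using power_law_potential_lower_bound[of \<beta> \<alpha>] \<beta>
    by (intro ereal_integral_eq_PInfty[where c = "1 / \<alpha> - 1 / \<beta>"] prob_space_axioms
        borel_measurable_power_law_potential \<mu>) auto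
  then show ?thesis
    by (simp add: interaction_energy_def case_prod_beta')
qed

lemma interaction_energy_equal_exponents: "interaction_energy \<alpha> \<alpha> \<mu> = 0"
  by (simp add: interaction_energy_def ereal_integral_def power_law_potential_def case_prod_beta'
      flip: zero_ereal_def)

lemma interaction_energy_lower_bound:
  fixes \<mu> :: "'a::{real_normed_vector, second_countable_topology} measure"
  assumes \<mu>: "\<mu> \<in> borel_prob_measures" and \<beta>: "0 < \<beta>" "\<beta> \<le> \<alpha>"
  shows "ereal (1 / 2 * (1 / \<alpha> - 1 / \<beta>)) \<le> interaction_energy \<alpha> \<beta> \<mu>"
proof (cases "finite_moment \<alpha> \<mu>")
  case True
  interpret prob_space "\<mu> \<Otimes>\<^sub>M \<mu>"
    using \<mu> by (rule prob_space_pair_borel)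
  have "1 / \<alpha> - 1 / \<beta> \<le> (\<integral>p. power_law_potential \<alpha> \<beta> (fst p - snd p) \<partial>(\<mu> \<Otimes>\<^sub>M \<mu>))"
    using power_law_potential_lower_bound[OF \<beta>]
    by (intro integral_ge_const integrable_power_law_potential \<mu> True \<beta>) auto
  then show ?thesis
    unfolding interaction_energy_eq[OF \<mu> True \<beta>] ereal_less_eq
    by (intro mult_left_mono) auto
next
  case False
  then show ?thesis
    using interaction_energy_eq_PInfty[OF \<mu> False \<beta>(1)] \<beta>
    by (cases "\<beta> = \<alpha>") (auto simp: interaction_energy_equal_exponents)
qed

lemma interaction_energy_concave:
  fixes \<mu> :: "'a::{real_normed_vector, second_countable_topology} measure"
  assumes \<mu>: "\<mu> \<in> borel_prob_measures" and fin: "finite_moment \<alpha> \<mu>"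
  shows "concave_on {0<..\<alpha>} (\<lambda>\<beta>. real_of_ereal (interaction_energy \<alpha> \<beta> \<mu>))"
proof (rule concave_on_linorderI)
  fix t x y :: real
  assume t: "0 < t" "t < 1" and x: "x \<in> {0<..\<alpha>}" and y: "y \<in> {0<..\<alpha>}"
  define z where "z = (1 - t) *\<^sub>R x + t *\<^sub>R y"
  have z: "z \<in> {0<..\<alpha>}"
    unfolding z_def using convexD[of "{0<..\<alpha>}" x y "1 - t" t] t x y by auto
  have W: "(1 - t) * power_law_potential \<alpha> x d + t * power_law_potential \<alpha> y d
      \<le> power_law_potential \<alpha> z d" for d :: 'a
    unfolding z_def using t x y
    by (intro concave_onD[OF concave_on_power_law_potential]) auto
  let ?I = "\<lambda>\<beta>. \<integral>p. power_law_potential \<alpha> \<beta> (fst p - snd p) \<partial>(\<mu> \<Otimes>\<^sub>M \<mu>)"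
  have int: "integrable (\<mu> \<Otimes>\<^sub>M \<mu>) (\<lambda>p. power_law_potential \<alpha> \<beta> (fst p - snd p))"
    if "\<beta> \<in> {0<..\<alpha>}" for \<beta>
    using that by (intro integrable_power_law_potential \<mu> fin) auto
  have "(1 - t) * ?I x + t * ?I y =
      (\<integral>p. (1 - t) * power_law_potential \<alpha> x (fst p - snd p)
        + t * power_law_potential \<alpha> y (fst p - snd p) \<partial>(\<mu> \<Otimes>\<^sub>M \<mu>))"
    using int[OF x] int[OF y] by simp
  also have "\<dots> \<le> ?I z"
    using int[OF x] int[OF y] int[OF z] W by (intro integral_mono) auto
  finally have "(1 - t) * ?I x + t * ?I y \<le> ?I z" .
  moreover have "real_of_ereal (interaction_energy \<alpha> \<beta> \<mu>) = 1 / 2 * ?I \<beta>"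
    if "\<beta> \<in> {0<..\<alpha>}" for \<beta>
    using that interaction_energy_eq[OF \<mu> fin] by simp
  note e = this[OF x] this[OF y] this[OF z]
  ultimately show "(1 - t) * real_of_ereal (interaction_energy \<alpha> x \<mu>)
      + t * real_of_ereal (interaction_energy \<alpha> y \<mu>)
      \<le> real_of_ereal (interaction_energy \<alpha> ((1 - t) *\<^sub>R x + t *\<^sub>R y) \<mu>)"
    unfolding z_def[symmetric] e by argo
qed simp

text \<open>
  The tangent of the convex function \<open>\<beta> \<mapsto> |z|\<^sup>\<beta> / \<beta>\<close> at \<open>\<alpha>\<close> has a slope of order \<open>|z|\<^sup>\<alpha> ln |z|\<close> for
  large \<open>|z|\<close>, which need not be integrable. Dominated convergence along sequences in
  \<open>(\<alpha> / 2, \<alpha>)\<close> avoids a quantitative estimate.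
\<close>

lemma interaction_energy_tendsto_zero:
  fixes \<mu> :: "'a::{real_normed_vector, second_countable_topology} measure"
  assumes \<mu>: "\<mu> \<in> borel_prob_measures" and fin: "finite_moment \<alpha> \<mu>" and "0 < \<alpha>"
  shows "((\<lambda>\<beta>. real_of_ereal (interaction_energy \<alpha> \<beta> \<mu>)) \<longlongrightarrow> 0) (at_left \<alpha>)"
proof (rule tendsto_at_left_sequentially[of "\<alpha> / 2"])
  interpret prob_space "\<mu> \<Otimes>\<^sub>M \<mu>"
    using \<mu> by (rule prob_space_pair_borel)
  fix S :: "nat \<Rightarrow> real"
  assume S: "\<And>n. S n < \<alpha>" "\<And>n. \<alpha> / 2 < S n" "S \<longlonglongrightarrow> \<alpha>"
  have pos: "0 < S n" for n
    using S(2)[of n] \<open>0 < \<alpha>\<close> by linarith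
  let ?W = "\<lambda>\<beta> p. power_law_potential \<alpha> \<beta> (fst p - snd p)"
  have "(\<lambda>n. \<integral>p. ?W (S n) p \<partial>(\<mu> \<Otimes>\<^sub>M \<mu>)) \<longlonglongrightarrow> (\<integral>p. 0 \<partial>(\<mu> \<Otimes>\<^sub>M \<mu>))"
  proof (rule integral_dominated_convergence)
    show "integrable (\<mu> \<Otimes>\<^sub>M \<mu>) (\<lambda>p. norm (fst p - snd p) powr \<alpha> / \<alpha> + 1 / (\<alpha> / 2))"
      using fin by (auto simp: finite_moment_def)
    show "AE p in \<mu> \<Otimes>\<^sub>M \<mu>. (\<lambda>n. ?W (S n) p) \<longlonglongrightarrow> 0"
    proof (rule AE_I2)
      fix p :: "'a \<times> 'a"
      have "(\<lambda>n. norm (fst p - snd p) powr S n) \<longlonglongrightarrow> norm (fst p - snd p) powr \<alpha>"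
      proof (cases "fst p = snd p")
        case False
        then show ?thesis
          using S(3) by (intro tendsto_powr) auto
      qed simp
      then have "(\<lambda>n. ?W (S n) p) \<longlonglongrightarrow> ?W \<alpha> p"
        unfolding power_law_potential_def using S(3) \<open>0 < \<alpha>\<close> by (intro tendsto_intros) auto
      then show "(\<lambda>n. ?W (S n) p) \<longlonglongrightarrow> 0"
        by (simp add: power_law_potential_def)
    qed
    show "AE p in \<mu> \<Otimes>\<^sub>M \<mu>.
        norm (?W (S n) p) \<le> norm (fst p - snd p) powr \<alpha> / \<alpha> + 1 / (\<alpha> / 2)" for n
      unfolding real_norm_def using S(1,2)[of n] \<open>0 < \<alpha>\<close>
      by (intro AE_I2 power_law_potential_abs_bound) auto
  qed (use borel_measurable_power_law_potential[OF \<mu>] in auto)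
  then have "(\<lambda>n. 1 / 2 * (\<integral>p. ?W (S n) p \<partial>(\<mu> \<Otimes>\<^sub>M \<mu>))) \<longlonglongrightarrow> 1 / 2 * 0"
    by (intro tendsto_mult_left) simp
  then show "(\<lambda>n. real_of_ereal (interaction_energy \<alpha> (S n) \<mu>)) \<longlonglongrightarrow> 0"
    using interaction_energy_eq[OF \<mu> fin] pos S(1) by (simp add: less_imp_le)
qed (use \<open>0 < \<alpha>\<close> in simp)

section \<open>The minimal energy over a family\<close>

lemma min_energy_equal_exponents:
  assumes "\<mu> \<in> \<F>"
  shows "min_energy \<F> \<alpha> \<alpha> = 0"
proof -
  have "\<F> \<noteq> {}"
    using assms by auto
  then show ?thesis
    by (simp add: min_energy_def interaction_energy_equal_exponents)
qed

lemma min_energy_le: "\<mu> \<in> \<F> \<Longrightarrow> min_energy \<F> \<alpha> \<beta> \<le> interaction_energy \<alpha> \<beta> \<mu>"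
  unfolding min_energy_def by (rule INF_lower)

lemma min_energy_lower_bound:
  fixes \<F> :: "'a::{real_normed_vector, second_countable_topology} measure set"
  assumes "\<F> \<subseteq> borel_prob_measures" "0 < \<beta>" "\<beta> \<le> \<alpha>"
  shows "ereal (1 / 2 * (1 / \<alpha> - 1 / \<beta>)) \<le> min_energy \<F> \<alpha> \<beta>"
  unfolding min_energy_def
  using assms by (intro INF_greatest interaction_energy_lower_bound) auto

lemma min_energy_finite:
  fixes \<F> :: "'a::{real_normed_vector, second_countable_topology} measure set"
  assumes "\<F> \<subseteq> borel_prob_measures" "\<mu> \<in> \<F>" "finite_moment \<alpha> \<mu>" "0 < \<beta>" "\<beta> \<le> \<alpha>"
  shows "\<bar>min_energy \<F> \<alpha> \<beta>\<bar> \<noteq> \<infinity>"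
proof -
  have "min_energy \<F> \<alpha> \<beta> \<le> interaction_energy \<alpha> \<beta> \<mu>"
    using assms(2) by (rule min_energy_le)
  moreover have "interaction_energy \<alpha> \<beta> \<mu> \<noteq> \<infinity>"
    using assms interaction_energy_eq[of \<mu> \<alpha> \<beta>] by auto
  ultimately show ?thesis
    using min_energy_lower_bound[OF assms(1,4,5)] by (cases "min_energy \<F> \<alpha> \<beta>") auto
qed

text \<open>
  A convex combination of values of the infimum is at most the same combination of values for
  each single measure. Measures without finite moment need a separate argument, since their energy
  is infinite: it suffices to treat \<open>x < y\<close>, and then the intermediate exponent is strictly below
  \<open>\<alpha>\<close> even if \<open>y = \<alpha>\<close>, so that their energy there is \<open>\<infinity>\<close>.
\<close>

lemma min_energy_concave:
  fixes \<F> :: "'a::{real_normed_vector, second_countable_topology} measure set"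
  assumes F: "\<F> \<subseteq> borel_prob_measures" and "\<mu>\<^sub>0 \<in> \<F>" "finite_moment \<alpha> \<mu>\<^sub>0"
  shows "concave_on {0<..\<alpha>} (\<lambda>\<beta>. real_of_ereal (min_energy \<F> \<alpha> \<beta>))"
proof (rule concave_on_linorderI)
  fix t x y :: real
  assume t: "0 < t" "t < 1" and x: "x \<in> {0<..\<alpha>}" and y: "y \<in> {0<..\<alpha>}" and "x < y"
  define z where "z = (1 - t) *\<^sub>R x + t *\<^sub>R y"
  have "z - y = (1 - t) * (x - y)"
    by (simp add: z_def algebra_simps)
  also have "\<dots> < 0"
    using t \<open>x < y\<close> by (simp add: mult_pos_neg)
  finally have "z < y"
    by simp
  moreover have "z \<in> {0<..\<alpha>}"
    unfolding z_def using convexD[of "{0<..\<alpha>}" x y "1 - t" t] t x y by auto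
  ultimately have z: "0 < z" "z < \<alpha>" "z \<le> \<alpha>"
    using y by auto
  let ?E = "\<lambda>\<beta>. real_of_ereal (min_energy \<F> \<alpha> \<beta>)"
  have E: "ereal (?E \<beta>) = min_energy \<F> \<alpha> \<beta>" if "0 < \<beta>" "\<beta> \<le> \<alpha>" for \<beta>
    using min_energy_finite[OF assms that] by (rule ereal_real')
  have "ereal ((1 - t) * ?E x + t * ?E y) \<le> interaction_energy \<alpha> z \<mu>" if "\<mu> \<in> \<F>" for \<mu>
  proof (cases "finite_moment \<alpha> \<mu>")
    case True
    let ?e = "\<lambda>\<beta>. real_of_ereal (interaction_energy \<alpha> \<beta> \<mu>)"
    have \<mu>: "\<mu> \<in> borel_prob_measures"
      using F that by auto
    have e: "ereal (?e \<beta>) = interaction_energy \<alpha> \<beta> \<mu>" if "0 < \<beta>" "\<beta> \<le> \<alpha>" for \<beta>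
      using interaction_energy_eq[OF \<mu> True that] by simp
    have le: "?E \<beta> \<le> ?e \<beta>" if "0 < \<beta>" "\<beta> \<le> \<alpha>" for \<beta>
      unfolding ereal_less_eq(3)[symmetric] E[OF that] e[OF that]
      using \<open>\<mu> \<in> \<F>\<close> by (rule min_energy_le)
    have "(1 - t) * ?E x + t * ?E y \<le> (1 - t) * ?e x + t * ?e y"
      using t x y le by (intro add_mono mult_left_mono) auto
    also have "\<dots> \<le> ?e z"
      unfolding z_def using t x y by (intro concave_onD[OF interaction_energy_concave[OF \<mu> True]]) auto
    finally have "ereal ((1 - t) * ?E x + t * ?E y) \<le> ereal (?e z)"
      by (simp only: ereal_less_eq(3))
    then show ?thesis
      by (simp only: e[OF z(1,3)])
  next
    case False
    then show ?thesis
      using F that z by (subst interaction_energy_eq_PInfty) auto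
  qed
  then have "ereal ((1 - t) * ?E x + t * ?E y) \<le> min_energy \<F> \<alpha> z"
    unfolding min_energy_def by (rule INF_greatest)
  then have "ereal ((1 - t) * ?E x + t * ?E y) \<le> ereal (?E z)"
    by (subst E[OF z(1,3)])
  then show "(1 - t) * ?E x + t * ?E y \<le> ?E ((1 - t) *\<^sub>R x + t *\<^sub>R y)"
    unfolding z_def ereal_less_eq(3) .
qed simp

text \<open>
  Concavity settles the interior. At \<open>\<alpha>\<close> the minimal energy is squeezed between the universal lower
  bound and the energy of \<open>\<mu>\<close>.
\<close>

lemma min_energy_continuous:
  fixes \<F> :: "'a::{real_normed_vector, second_countable_topology} measure set"
  assumes F: "\<F> \<subseteq> borel_prob_measures" and \<mu>: "\<mu> \<in> \<F>" "finite_moment \<alpha> \<mu>" and "0 < \<alpha>"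
  shows "continuous_on {0<..\<alpha>} (\<lambda>\<beta>. real_of_ereal (min_energy \<F> \<alpha> \<beta>))"
    (is "continuous_on _ ?E")
proof -
  have "concave_on {0<..<\<alpha>} ?E"
    using min_energy_concave[OF F \<mu>] unfolding concave_on_def
    by (rule convex_on_subset) auto
  then have "continuous_on {0<..<\<alpha>} (\<lambda>\<beta>. - ?E \<beta>)"
    unfolding concave_on_def by (intro convex_on_continuous) auto
  then have inner: "continuous_on {0<..<\<alpha>} ?E"
    using continuous_on_minus[of "{0<..<\<alpha>}" "\<lambda>\<beta>. - ?E \<beta>"] by simp
  have E: "ereal (?E \<beta>) = min_energy \<F> \<alpha> \<beta>" if "0 < \<beta>" "\<beta> \<le> \<alpha>" for \<beta>
    using min_energy_finite[OF F \<mu> that] by (rule ereal_real')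
  have near: "\<forall>\<^sub>F \<beta> in at_left \<alpha>. \<beta> \<in> {0<..<\<alpha>}"
    using eventually_at_left_real[OF \<open>0 < \<alpha>\<close>] .
  have "(?E \<longlongrightarrow> 0) (at_left \<alpha>)"
  proof (rule tendsto_sandwich)
    have "((\<lambda>\<beta>. 1 / 2 * (1 / \<alpha> - 1 / \<beta>)) \<longlongrightarrow> 1 / 2 * (1 / \<alpha> - 1 / \<alpha>)) (at_left \<alpha>)"
      using \<open>0 < \<alpha>\<close> by (intro tendsto_intros) auto
    then show "((\<lambda>\<beta>. 1 / 2 * (1 / \<alpha> - 1 / \<beta>)) \<longlongrightarrow> 0) (at_left \<alpha>)"
      by simp
    show "((\<lambda>\<beta>. real_of_ereal (interaction_energy \<alpha> \<beta> \<mu>)) \<longlongrightarrow> 0) (at_left \<alpha>)"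
      using F \<mu> \<open>0 < \<alpha>\<close> by (intro interaction_energy_tendsto_zero) auto
    show "\<forall>\<^sub>F \<beta> in at_left \<alpha>. 1 / 2 * (1 / \<alpha> - 1 / \<beta>) \<le> ?E \<beta>"
      using near
    proof eventually_elim
      case (elim \<beta>)
      then have \<beta>: "0 < \<beta>" "\<beta> \<le> \<alpha>"
        by auto
      have "ereal (1 / 2 * (1 / \<alpha> - 1 / \<beta>)) \<le> ereal (?E \<beta>)"
        unfolding E[OF \<beta>] using F \<beta> by (rule min_energy_lower_bound)
      then show ?case
        unfolding ereal_less_eq(3) .
    qed
    show "\<forall>\<^sub>F \<beta> in at_left \<alpha>. ?E \<beta> \<le> real_of_ereal (interaction_energy \<alpha> \<beta> \<mu>)"
      using near
    proof eventually_elim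
      case (elim \<beta>)
      then have \<beta>: "0 < \<beta>" "\<beta> \<le> \<alpha>"
        by auto
      have e: "ereal (real_of_ereal (interaction_energy \<alpha> \<beta> \<mu>)) = interaction_energy \<alpha> \<beta> \<mu>"
        using interaction_energy_eq[OF _ \<mu>(2) \<beta>] F \<mu>(1) by auto
      have "ereal (?E \<beta>) \<le> ereal (real_of_ereal (interaction_energy \<alpha> \<beta> \<mu>))"
        unfolding E[OF \<beta>] e using \<mu>(1) by (rule min_energy_le)
      then show ?case
        unfolding ereal_less_eq(3) .
    qed
  qed
  moreover have "?E \<alpha> = 0"
    using min_energy_equal_exponents[OF \<mu>(1)] by simp
  ultimately have left: "(?E \<longlongrightarrow> ?E \<alpha>) (at_left \<alpha>)"
    by simp
  show ?thesis
    unfolding continuous_on_def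
  proof
    fix \<beta>
    assume \<beta>: "\<beta> \<in> {0<..\<alpha>}"
    show "(?E \<longlongrightarrow> ?E \<beta>) (at \<beta> within {0<..\<alpha>})"
    proof (cases "\<beta> = \<alpha>")
      case True
      have "at \<alpha> within {0<..\<alpha>} = at_left \<alpha>"
        by (rule at_within_nhd[where S = "{0<..}"]) (use \<open>0 < \<alpha>\<close> in auto)
      with left True show ?thesis
        by simp
    next
      case False
      then have "(?E \<longlongrightarrow> ?E \<beta>) (at \<beta>)"
        using inner \<beta> by (auto simp: continuous_on_eq_continuous_at isCont_def)
      then show ?thesis
        by (rule tendsto_within_subset) simp
    qed
  qed
qed

lemma interaction_energy_return:
  fixes a :: "'a::{real_normed_vector, second_countable_topology}"
  assumes "0 < \<beta>" "\<beta> \<le> \<alpha>"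
  shows "return borel a \<in> borel_prob_measures"
    and "finite_moment \<alpha> (return borel a)"
    and "interaction_energy \<alpha> \<beta> (return borel a) = 0"
proof -
  let ?\<delta> = "return borel a"
  show \<delta>: "?\<delta> \<in> borel_prob_measures"
    by (simp add: borel_prob_measures_def prob_space_return)
  have pair: "?\<delta> \<Otimes>\<^sub>M ?\<delta> = return (borel \<Otimes>\<^sub>M borel) (a, a)"
    by (intro pair_measure_eqI) (auto simp: prob_space_return prob_space_imp_sigma_finite
        emeasure_return indicator_times cong: sets_pair_measure_cong)
  show fin: "finite_moment \<alpha> ?\<delta>"
    unfolding finite_moment_def pair integrable_iff_bounded
    by (auto simp: nn_integral_return space_pair_measure)
  show "interaction_energy \<alpha> \<beta> ?\<delta> = 0"
    unfolding interaction_energy_eq[OF \<delta> fin assms] unfolding pair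
    by (subst integral_return) (auto simp: power_law_potential_def space_pair_measure)
qed

text \<open>
  Every \<open>y \<in> [x, \<alpha>]\<close> is a convex combination of \<open>x\<close> and \<open>\<alpha>\<close>. The minimal energy is \<open>0\<close> at \<open>\<alpha>\<close> and,
  because of the point mass, at most \<open>0\<close> at \<open>x\<close>, so concavity bounds its value at \<open>y\<close> from below by
  its value at \<open>x\<close>.
\<close>

lemma min_energy_all_mono:
  assumes "0 < \<alpha>"
  shows "mono_on {0<..\<alpha>} (\<lambda>\<beta>. min_energy
    (borel_prob_measures :: 'a::{real_normed_vector, second_countable_topology} measure set) \<alpha> \<beta>)"
proof (rule mono_onI)
  let ?P = "borel_prob_measures :: 'a measure set"
  let ?\<delta> = "return borel (0 :: 'a)"
  let ?E = "\<lambda>\<beta>. real_of_ereal (min_energy ?P \<alpha> \<beta>)"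
  fix x y
  assume x: "x \<in> {0<..\<alpha>}" and y: "y \<in> {0<..\<alpha>}" and "x \<le> y"
  have \<delta>: "?\<delta> \<in> ?P" "finite_moment \<alpha> ?\<delta>"
    using interaction_energy_return[of \<alpha> \<alpha>] \<open>0 < \<alpha>\<close> by auto
  have E: "ereal (?E \<beta>) = min_energy ?P \<alpha> \<beta>" if "0 < \<beta>" "\<beta> \<le> \<alpha>" for \<beta>
    using min_energy_finite[OF subset_refl \<delta> that] by (rule ereal_real')
  have "ereal (?E x) = min_energy ?P \<alpha> x"
    using x by (intro E) auto
  also have "\<dots> \<le> interaction_energy \<alpha> x ?\<delta>"
    using \<delta>(1) by (rule min_energy_le)
  also have "\<dots> = 0"
    using x by (intro interaction_energy_return) auto
  finally have nonpos: "?E x \<le> 0"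
    by simp
  have E\<alpha>: "?E \<alpha> = 0"
    using min_energy_equal_exponents[OF \<delta>(1)] by simp
  have "?E x \<le> ?E y"
  proof (cases "x = \<alpha>")
    case True
    with \<open>x \<le> y\<close> y show ?thesis
      by auto
  next
    case False
    define t where "t = (y - x) / (\<alpha> - x)"
    have t: "0 \<le> t" "t \<le> 1"
      using False x y \<open>x \<le> y\<close> by (auto simp: t_def)
    have "t * (\<alpha> - x) = y - x"
      using False by (simp add: t_def)
    then have y_eq: "y = (1 - t) *\<^sub>R x + t *\<^sub>R \<alpha>"
      by (simp add: algebra_simps)
    have "?E x \<le> (1 - t) * ?E x"
      using t nonpos by (simp add: algebra_simps mult_nonneg_nonpos)
    also have "\<dots> = (1 - t) * ?E x + t * ?E \<alpha>"
      by (simp add: E\<alpha>)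
    also have "\<dots> \<le> ?E y"
      unfolding y_eq using t x \<open>0 < \<alpha>\<close>
      by (intro concave_onD[OF min_energy_concave[OF subset_refl \<delta>]]) auto
    finally show ?thesis .
  qed
  then have "ereal (?E x) \<le> ereal (?E y)"
    by simp
  moreover have "ereal (?E x) = min_energy ?P \<alpha> x" "ereal (?E y) = min_energy ?P \<alpha> y"
    using x y by (auto intro!: E)
  ultimately show "min_energy ?P \<alpha> x \<le> min_energy ?P \<alpha> y"
    by (simp only:)
qed

theorem proposition1p5:
  fixes \<alpha> \<beta>\<^sub>0 :: real
    and \<F> :: "(real ^ 'n) measure set"
  assumes "0 < \<alpha>"
    and "\<beta>\<^sub>0 \<in> {0<..<\<alpha>}"
    and "\<F> \<subseteq> borel_prob_measures"
    and "\<F> \<noteq> {}"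
    and "\<exists>\<mu>\<in>\<F>. interaction_energy \<alpha> \<beta>\<^sub>0 \<mu> < \<infinity>"
  shows "(\<forall>\<beta>\<in>{0<..\<alpha>}. \<bar>min_energy \<F> \<alpha> \<beta>\<bar> \<noteq> \<infinity>) \<and>
    continuous_on {0<..\<alpha>} (\<lambda>\<beta>. real_of_ereal (min_energy \<F> \<alpha> \<beta>)) \<and>
    concave_on {0<..\<alpha>} (\<lambda>\<beta>. real_of_ereal (min_energy \<F> \<alpha> \<beta>)) \<and>
    mono_on {0<..\<alpha>}
      (\<lambda>\<beta>. min_energy (borel_prob_measures :: (real ^ 'n) measure set) \<alpha> \<beta>)"
proof -
  obtain \<mu> where \<mu>: "\<mu> \<in> \<F>" "interaction_energy \<alpha> \<beta>\<^sub>0 \<mu> < \<infinity>"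
    using assms(5) by blast
  have "finite_moment \<alpha> \<mu>"
    using interaction_energy_eq_PInfty[of \<mu> \<alpha> \<beta>\<^sub>0] \<mu> assms(2,3) by auto
  then show ?thesis
    using min_energy_finite[OF assms(3) \<mu>(1)] min_energy_continuous[OF assms(3) \<mu>(1)]
      min_energy_concave[OF assms(3) \<mu>(1)] min_energy_all_mono \<open>0 < \<alpha>\<close>
    by simp
qed

end
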